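(* Let $L_1$ and $L_2$ be two distinct rooted trees with $\ell$ vertices, and let $\ell_{1,n}$ and $\ell_{2,n}$ denote the number of $n$-vertex rooted trees without $L_1$, respectively without $L_2$, as a maximal limb. Then $\ell_{1,n}=\ell_{2,n}$.
   Context: Rooted trees are finite and are counted up to root-preserving isomorphism. For a rooted tree $T$ and a vertex $v$ of $T$, the maximal limb at $v$ is the rooted subtree of $T$ with root $v$ consisting of $v$ and all descendants of $v$. The tree $T$ has $L$ as a maximal limb if for some vertex $v$ of $T$ the maximal limb at $v$ is isomorphic to $L$ as a rooted tree. *)

theory Defs
  imports "Graph_Theory.Graph_Theory"
begin

text \<open>
  Graphs are the finite loop-free symmetric digraphs \<^const>\<open>pair_graph\<close>. There a path \<open>a, b, a\<close>
  counts as a cycle, so the library predicate \<^const>\<open>tree\<close> fails for every symmetric digraph with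
  an edge; the cycles of the underlying undirected graph are those of length at least 3.
\<close>

definition undirected_tree :: "'a pair_pre_digraph \<Rightarrow> bool" where
  "undirected_tree G \<longleftrightarrow> pair_graph G \<and> connected G \<and>
     \<not> (\<exists>p. pre_digraph.cycle G p \<and> 3 \<le> length p)"

text \<open>The second component is the root.\<close>

type_synonym 'a rooted_graph = "'a pair_pre_digraph \<times> 'a"

definition rooted_tree :: "'a rooted_graph \<Rightarrow> bool" where
  "rooted_tree T \<longleftrightarrow> undirected_tree (fst T) \<and> snd T \<in> pverts (fst T)"

definition num_verts :: "'a rooted_graph \<Rightarrow> nat" where
  "num_verts T = card (pverts (fst T))"

definition rooted_iso :: "'a rooted_graph \<Rightarrow> 'b rooted_graph \<Rightarrow> bool" where
  "rooted_iso S T \<longleftrightarrow>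
     (\<exists>f. pre_digraph.digraph_isomorphism (fst S) f \<and> with_proj (fst T) = app_iso f (fst S) \<and>
          iso_verts f (snd S) = snd T)"

text \<open>
  The vertices \<open>w\<close> whose path from the root passes through \<open>v\<close>: the vertex \<open>v\<close> itself and
  all its descendants.
\<close>

definition descendants :: "'a rooted_graph \<Rightarrow> 'a \<Rightarrow> 'a set" where
  "descendants T v =
     {w. \<exists>p. pre_digraph.apath (fst T) (snd T) p w \<and>
             v \<in> set (pre_digraph.awalk_verts (fst T) (snd T) p)}"

definition max_limb :: "'a rooted_graph \<Rightarrow> 'a \<Rightarrow> 'a rooted_graph" where
  "max_limb T v =
     (\<lparr>pverts = descendants T v,
       parcs = {e \<in> parcs (fst T). fst e \<in> descendants T v \<and> snd e \<in> descendants T v}\<rparr>, v)"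

lemma max_limb_induce_subgraph:
  "with_proj (fst (max_limb T v)) = with_proj (fst T) \<restriction> descendants T v"
  by (simp add: max_limb_def with_proj_def induce_subgraph_def)

definition has_max_limb :: "'a rooted_graph \<Rightarrow> 'b rooted_graph \<Rightarrow> bool" where
  "has_max_limb T L \<longleftrightarrow> (\<exists>v \<in> pverts (fst T). rooted_iso (max_limb T v) L)"

definition trees_without_limb :: "'a rooted_graph \<Rightarrow> nat \<Rightarrow> nat rooted_graph set" where
  "trees_without_limb L n = {T. rooted_tree T \<and> num_verts T = n \<and> \<not> has_max_limb T L}"

definition num_trees_without_limb :: "'a rooted_graph \<Rightarrow> nat \<Rightarrow> nat" where
  "num_trees_without_limb L n = card (trees_without_limb L n // {(S, T). rooted_iso S T})"


text \<open>
  \<^const>\<open>rooted_iso\<close> is an equivalence relation on rooted trees and there are only finitely many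
  classes with \<open>n\<close> vertices, so that the cardinality above is a genuine count.
\<close>

lemma rooted_iso_iff:
  assumes "pair_wf_digraph (fst S)"
  shows "rooted_iso S T \<longleftrightarrow>
    (\<exists>f. bij_betw f (pverts (fst S)) (pverts (fst T)) \<and>
         map_prod f f ` parcs (fst S) = parcs (fst T) \<and> f (snd S) = snd T)"
    (is "?L \<longleftrightarrow> ?R")
proof
  assume ?L
  then obtain h where h: "pre_digraph.digraph_isomorphism (fst S) h"
      "with_proj (fst T) = app_iso h (fst S)" "iso_verts h (snd S) = snd T"
    by (auto simp: rooted_iso_def)
  have eqs: "pverts (fst T) = iso_verts h ` pverts (fst S)"
      "parcs (fst T) = iso_arcs h ` parcs (fst S)"
      "iso_tail h = fst" "iso_head h = snd"
    using h(2) by (auto simp: with_proj_def app_iso_def)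
  have inj: "inj_on (iso_verts h) (pverts (fst S))"
    using h(1) by (simp add: pre_digraph.digraph_isomorphism_def)
  have "iso_arcs h a = map_prod (iso_verts h) (iso_verts h) a" if "a \<in> parcs (fst S)" for a
    using h(1) that eqs(3,4)
    by (auto simp: pre_digraph.digraph_isomorphism_def prod_eq_iff)
  then have "map_prod (iso_verts h) (iso_verts h) ` parcs (fst S) = parcs (fst T)"
    unfolding eqs(2) by (intro image_cong) auto
  then show ?R
    using inj eqs(1) h(3) by (auto simp: bij_betw_def intro!: exI[of _ "iso_verts h"])
next
  assume ?R
  then obtain f where f: "bij_betw f (pverts (fst S)) (pverts (fst T))"
      "map_prod f f ` parcs (fst S) = parcs (fst T)" "f (snd S) = snd T" by blast
  let ?h = "\<lparr>iso_verts = f, iso_arcs = map_prod f f, iso_head = snd, iso_tail = fst\<rparr>"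
  have "inj_on (map_prod f f) (pverts (fst S) \<times> pverts (fst S))"
    using f(1) by (auto simp: bij_betw_def intro: map_prod_inj_on)
  moreover have "parcs (fst S) \<subseteq> pverts (fst S) \<times> pverts (fst S)"
    using assms by (auto dest: pair_wf_digraph.wellformed')
  ultimately have "inj_on (map_prod f f) (parcs (fst S))"
    by (rule inj_on_subset)
  then have "pre_digraph.digraph_isomorphism (fst S) ?h"
    using f(1) assms
    by (auto simp: pre_digraph.digraph_isomorphism_def wf_digraph_wp_iff bij_betw_def)
  moreover have "with_proj (fst T) = app_iso ?h (fst S)"
    using f(1,2) by (simp add: with_proj_def app_iso_def bij_betw_def)
  ultimately show ?L
    using f(3) by (auto simp: rooted_iso_def intro!: exI[of _ ?h])
qed

lemma rooted_iso_refl: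
  assumes "pair_wf_digraph (fst S)"
  shows "rooted_iso S S"
  using assms by (auto simp: rooted_iso_iff map_prod.id intro!: exI[of _ id])

lemma rooted_iso_sym:
  assumes S: "pair_wf_digraph (fst S)" "snd S \<in> pverts (fst S)" and T: "pair_wf_digraph (fst T)"
    and "rooted_iso S T"
  shows "rooted_iso T S"
proof -
  from assms obtain f where f: "bij_betw f (pverts (fst S)) (pverts (fst T))"
    "map_prod f f ` parcs (fst S) = parcs (fst T)" "f (snd S) = snd T"
    by (auto simp: rooted_iso_iff)
  define g where "g = inv_into (pverts (fst S)) f"
  have gf: "g (f x) = x" if "x \<in> pverts (fst S)" for x
    using f(1) that by (simp add: g_def bij_betw_def)
  have "map_prod g g (map_prod f f e) = e" if "e \<in> parcs (fst S)" for e
    using gf pair_wf_digraph.arc_fst_in_verts[OF S(1) that]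
      pair_wf_digraph.arc_snd_in_verts[OF S(1) that]
    by (simp add: prod_eq_iff)
  then have "map_prod g g ` parcs (fst T) = parcs (fst S)"
    unfolding f(2)[symmetric] image_image by simp
  moreover have "bij_betw g (pverts (fst T)) (pverts (fst S))"
    using f(1) unfolding g_def by (rule bij_betw_inv_into)
  moreover have "g (snd T) = snd S"
    using gf[of "snd S"] S(2) f(3) by simp
  ultimately show ?thesis
    using T by (auto simp: rooted_iso_iff)
qed

lemma rooted_iso_trans:
  assumes "pair_wf_digraph (fst S)" "pair_wf_digraph (fst T)"
    and "rooted_iso S T" "rooted_iso T U"
  shows "rooted_iso S U"
proof -
  from assms obtain f where f: "bij_betw f (pverts (fst S)) (pverts (fst T))"
    "map_prod f f ` parcs (fst S) = parcs (fst T)" "f (snd S) = snd T"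
    by (auto simp: rooted_iso_iff)
  from assms obtain g where g: "bij_betw g (pverts (fst T)) (pverts (fst U))"
    "map_prod g g ` parcs (fst T) = parcs (fst U)" "g (snd T) = snd U"
    by (auto simp: rooted_iso_iff)
  have "bij_betw (g \<circ> f) (pverts (fst S)) (pverts (fst U))"
    using f(1) g(1) by (rule bij_betw_trans)
  moreover have "map_prod (g \<circ> f) (g \<circ> f) ` parcs (fst S) = parcs (fst U)"
    unfolding g(2)[symmetric] f(2)[symmetric] map_prod.comp[symmetric] image_comp[symmetric] ..
  ultimately show ?thesis
    using assms(1) f(3) g(3) by (auto simp: rooted_iso_iff intro!: exI[of _ "g \<circ> f"])
qed

lemma rooted_tree_wf:
  assumes "rooted_tree T"
  shows "pair_wf_digraph (fst T)" "finite (pverts (fst T))" "snd T \<in> pverts (fst T)"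
proof -
  have "pair_fin_digraph (fst T)"
    using assms by (auto simp: rooted_tree_def undirected_tree_def pair_graph_def pair_digraph_def)
  then show "pair_wf_digraph (fst T)" "finite (pverts (fst T))"
    by (auto simp: pair_fin_digraph_def pair_fin_digraph_axioms_def)
  show "snd T \<in> pverts (fst T)"
    using assms by (simp add: rooted_tree_def)
qed

lemma equiv_rooted_iso:
  "equiv {T :: 'a rooted_graph. rooted_tree T}
     {(S, T). rooted_tree S \<and> rooted_tree T \<and> rooted_iso S T}"
  (is "equiv ?A ?r")
proof (rule equivI)
  show "?r \<subseteq> ?A \<times> ?A" by blast
  show "refl_on ?A ?r"
    by (rule refl_onI) (use rooted_iso_refl rooted_tree_wf(1) in blast)
  show "sym ?r"
    by (rule symI) (use rooted_iso_sym rooted_tree_wf(1,3) in blast)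
  show "trans ?r"
    by (rule transI) (use rooted_iso_trans rooted_tree_wf(1) in blast)
qed

lemma finite_rooted_tree_classes:
  "finite (trees_without_limb L n // {(S, T). rooted_iso S T})"
proof -
  let ?r = "{(S :: nat rooted_graph, T). rooted_iso S T}"
  let ?D = "(\<lambda>(A, v). (\<lparr>pverts = {..<n}, parcs = A\<rparr>, v)) ` (Pow ({..<n} \<times> {..<n}) \<times> {..<n})"
  have "\<exists>T' \<in> ?D. ?r `` {T} = ?r `` {T'}" if "T \<in> trees_without_limb L n" for T
  proof -
    have tree: "rooted_tree T" and n: "card (pverts (fst T)) = n"
      using that by (auto simp: trees_without_limb_def num_verts_def)
    note wf = rooted_tree_wf[OF tree]
    obtain f where f: "bij_betw f (pverts (fst T)) {..<n}"
      using ex_bij_betw_finite_nat[OF wf(2)] by (auto simp: n atLeast0LessThan)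
    define T' where
      "T' = (\<lparr>pverts = {..<n}, parcs = map_prod f f ` parcs (fst T)\<rparr>, f (snd T))"
    have fv: "f x < n" if "x \<in> pverts (fst T)" for x
      using f that by (auto simp: bij_betw_def)
    have wf': "pair_wf_digraph (fst T')"
      using wf(1) by (auto simp: T'_def pair_wf_digraph_def intro!: fv)
    have iso: "rooted_iso T T'"
      unfolding rooted_iso_iff[OF wf(1)] using f by (auto simp: T'_def)
    have "rooted_iso T' T"
      using rooted_iso_sym[OF wf(1,3) wf' iso] .
    then have "?r `` {T} = ?r `` {T'}"
      using iso rooted_iso_trans[OF wf(1) wf'] rooted_iso_trans[OF wf' wf(1)] by blast
    moreover have "T' \<in> ?D"
      using wf(3) pair_wf_digraph.arc_fst_in_verts[OF wf(1)]
        pair_wf_digraph.arc_snd_in_verts[OF wf(1)]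
      by (force simp: T'_def intro!: fv)
    ultimately show ?thesis by blast
  qed
  then have "trees_without_limb L n // ?r \<subseteq> (\<lambda>T. ?r `` {T}) ` ?D"
    unfolding quotient_def by blast
  moreover have "finite ((\<lambda>T. ?r `` {T}) ` ?D)" by simp
  ultimately show ?thesis by (rule finite_subset)
qed

end

theory Submission
  imports Defs "HOL-Library.Multiset"
begin

text \<open>
  Up to isomorphism a rooted tree is a finite multiset of rooted trees, the maximal limbs at the
  children of its root, and its maximal limbs are itself and the hereditary members of this
  multiset. On such hereditary multisets, replace every maximal limb \<open>L\<^sub>1\<close> by \<open>L\<^sub>2\<close> and vice versa. Since \<open>L\<^sub>1\<close> and
  \<open>L\<^sub>2\<close> have equally many vertices, neither is a proper limb of the other and no new copies arise,
  so this is an involution. It preserves the number of vertices and exchanges the trees without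
  \<open>L\<^sub>1\<close> and those without \<open>L\<^sub>2\<close>.
\<close>

section \<open>Arborescences\<close>

text \<open>Arcs point from parent to child. The vertices are left implicit as the points reachable
  from \<open>r\<close>, so the one-vertex tree is the empty relation. Reachability of tails extends
  to heads by one more arc.\<close>

locale arborescence =
  fixes C :: "'a rel" and r :: 'a
  assumes finite_arcs: "finite C"
    and parent_unique: "(u, w) \<in> C \<Longrightarrow> (v, w) \<in> C \<Longrightarrow> u = v"
    and root_orphan: "(u, r) \<notin> C"
    and tail_reachable: "(u, v) \<in> C \<Longrightarrow> (r, u) \<in> C\<^sup>*"
begin

lemma finite_children: "finite (C `` {v})"
  using finite_arcs by (rule finite_Image)

lemma finite_descendants: "finite (C\<^sup>* `` {v})"
proof -
  have "C\<^sup>* `` {v} \<subseteq> insert v (snd ` C)"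
  proof
    fix x assume "x \<in> C\<^sup>* `` {v}"
    then have "(v, x) \<in> C\<^sup>*" by simp
    then show "x \<in> insert v (snd ` C)"
      by cases (auto intro: rev_image_eqI)
  qed
  then show ?thesis
    using finite_arcs finite_subset by blast
qed

text \<open>Induction outward from the root: a cycle through a vertex enters it by its unique
  parent, hence passes through the parent too, and the root has no parent.\<close>

lemma acyclic: "acyclic C"
proof -
  have "(x, x) \<notin> C\<^sup>+" if "(r, x) \<in> C\<^sup>*" for x
    using that
  proof (induction rule: rtrancl_induct)
    case base
    then show ?case using root_orphan by (blast dest: tranclD2)
  next
    case (step y z)
    show ?case
    proof
      assume "(z, z) \<in> C\<^sup>+"
      then obtain w where "(z, w) \<in> C\<^sup>*" "(w, z) \<in> C"
        by (meson tranclD2)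
      then have "(z, y) \<in> C\<^sup>*"
        using parent_unique step.hyps(2) by blast
      then show False
        using step by (meson rtrancl_into_trancl2)
    qed
  qed
  then show ?thesis
    unfolding acyclic_def using tail_reachable by (meson tranclD)
qed

text \<open>The first supports recursion from parents to children, which builds isomorphisms; the
  second supports recursion from the leaves upwards, which computes shapes.\<close>

lemma wf_arcs: "wf C" and wf_converse_arcs: "wf (C\<inverse>)"
  using finite_arcs acyclic by (auto intro: finite_acyclic_wf finite_acyclic_wf_converse)

text \<open>A directed path that starts at \<open>v\<close> meets only descendants of
  \<open>v\<close>, so the restriction loses none of its arcs.\<close>

lemma rtrancl_sub_arborescence:
  assumes "(v, x) \<in> C\<^sup>*"
  shows "(v, x) \<in> (C \<inter> (C\<^sup>* `` {v}) \<times> (C\<^sup>* `` {v}))\<^sup>*"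
  using assms
proof (induction rule: rtrancl_induct)
  case (step y z)
  then have "(y, z) \<in> C \<inter> (C\<^sup>* `` {v}) \<times> (C\<^sup>* `` {v})"
    by (auto intro: rtrancl_into_rtrancl)
  then show ?case
    using step.IH by (rule rtrancl_into_rtrancl[rotated])
qed simp

lemma sub_arborescence: "arborescence (C \<inter> (C\<^sup>* `` {v}) \<times> (C\<^sup>* `` {v})) v"
proof
  show "finite (C \<inter> (C\<^sup>* `` {v}) \<times> (C\<^sup>* `` {v}))"
    using finite_arcs by simp
  show "(u, v) \<notin> C \<inter> (C\<^sup>* `` {v}) \<times> (C\<^sup>* `` {v})" for u
    using acyclic by (auto simp: acyclic_def dest: rtrancl_into_trancl1)
qed (use parent_unique rtrancl_sub_arborescence in blast)+

lemma descendants_sub_arborescence: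
  "(C \<inter> (C\<^sup>* `` {v}) \<times> (C\<^sup>* `` {v}))\<^sup>* `` {v} = C\<^sup>* `` {v}"
  using rtrancl_sub_arborescence rtrancl_mono[of "C \<inter> (C\<^sup>* `` {v}) \<times> (C\<^sup>* `` {v})" C] by blast

end

section \<open>Uniqueness of the orientation away from the root\<close>

text \<open>The root and the undirected edges determine the directions: going outward, every edge at
  a vertex other than the one to its parent must lead to a child.\<close>

lemma arborescence_orientation_subset:
  assumes "arborescence C r" "arborescence D r" "C \<union> C\<inverse> = D \<union> D\<inverse>"
  shows "C \<subseteq> D"
proof -
  interpret C: arborescence C r by fact
  interpret D: arborescence D r by fact
  have "\<forall>v. (u, v) \<in> C \<longrightarrow> (u, v) \<in> D" if "(r, u) \<in> C\<^sup>*" for u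
    using that
  proof (induction rule: rtrancl_induct)
    case base
    then show ?case using assms(3) D.root_orphan by blast
  next
    case (step x y)
    show ?case
    proof (intro allI impI)
      fix v assume yv: "(y, v) \<in> C"
      show "(y, v) \<in> D"
      proof (rule ccontr)
        assume "(y, v) \<notin> D"
        then have "(v, y) \<in> D" using assms(3) yv by blast
        \<comment> \<open>By induction \<open>x\<close> is also the parent of \<open>y\<close> in
          \<open>D\<close>. With \<open>v = x\<close>, the arcs between \<open>x\<close> and
          \<open>y\<close> would form a directed 2-cycle in \<open>C\<close>.\<close>
        then have "v = x" using step D.parent_unique by blast
        then show False
          using yv step.hyps(2) C.acyclic by (meson acyclic_def r_into_trancl trancl_into_trancl)
      qed
    qed
  qed
  then show ?thesis
    using C.tail_reachable by auto
qed

lemma arborescence_orientation_unique: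
  assumes "arborescence C r" "arborescence D r" "C \<union> C\<inverse> = D \<union> D\<inverse>"
  shows "C = D"
  using arborescence_orientation_subset[OF assms]
    arborescence_orientation_subset[OF assms(2,1) assms(3)[symmetric]] by blast

text \<open>Each arc is entered in both directions, since trees are represented by symmetric
  digraphs.\<close>

definition arborescence_graph :: "'a rel \<Rightarrow> 'a \<Rightarrow> 'a rooted_graph" where
  "arborescence_graph C r = (\<lparr>pverts = C\<^sup>* `` {r}, parcs = C \<union> C\<inverse>\<rparr>, r)"

lemma arborescence_graph_simps [simp]:
  "pverts (fst (arborescence_graph C r)) = C\<^sup>* `` {r}"
  "parcs (fst (arborescence_graph C r)) = C \<union> C\<inverse>"
  "snd (arborescence_graph C r) = r"
  by (simp_all add: arborescence_graph_def)

section \<open>Rooted trees as arborescences\<close>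

context pair_graph
begin

text \<open>After the common initial part the two paths leave some \<open>u\<close> towards
  different neighbours \<open>a\<close> and \<open>b\<close>. Following one remainder and returning
  along the other joins \<open>a\<close> to \<open>b\<close> while avoiding \<open>u\<close>;
  closing up through \<open>u\<close> gives the cycle.\<close>

lemma long_cycle_if_two_apaths:
  assumes "apath u p v" "apath u q v" "p \<noteq> q"
  shows "\<exists>c. cycle c \<and> 3 \<le> length c"
  using assms
proof (induction p arbitrary: u q)
  case Nil
  then show ?case using apath_nonempty_ends by (auto simp: apath_Nil_iff)
next
  case (Cons d p)
  then obtain e q' where q: "q = e # q'"
    using apath_nonempty_ends by (cases q) (auto simp: apath_Nil_iff)
  show ?case
  proof (cases "d = e")
    case True
    then show ?thesis using Cons q by (auto simp: apath_Cons_iff)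
  next
    case False
    obtain a b where d: "d = (u, a)" and e: "e = (u, b)"
      using Cons.prems q by (metis apath_Cons_iff prod.collapse)
    then have "a \<noteq> b" using False by simp
    have dG: "(u, a) \<in> parcs G" and eG: "(u, b) \<in> parcs G"
      using Cons.prems q d e by (auto simp: apath_Cons_iff)
    have "apath a p v" "apath b q' v"
      and "u \<notin> set (awalk_verts a p)" "u \<notin> set (awalk_verts b q')"
      using Cons.prems q d e by (auto simp: apath_Cons_iff)
    then have p: "awalk a p v" "u \<notin> set (awalk_verts a p)"
      and q': "awalk b q' v" "u \<notin> set (awalk_verts b q')"
      by (auto simp: apath_def)
    let ?w = "p @ rev_path q'"
    have w: "awalk a ?w b"
      using p(1) q'(1) by (intro awalk_appendI) simp_all
    have "set (awalk_verts a ?w) = set (awalk_verts a p) \<union> set (awalk_verts v (rev_path q'))"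
      using p(1) q'(1) by (intro set_awalk_verts_append) simp_all
    then have uw: "u \<notin> set (awalk_verts a ?w)"
      using p q' by (simp add: awalk_verts_rev_path)
    \<comment> \<open>The two remainders may meet before \<open>v\<close>, so the walk is shortened
      to a path. It stays nonempty because \<open>a\<close> and \<open>b\<close> differ, which
      yields at least three arcs.\<close>
    let ?s = "awalk_to_apath ?w"
    have s: "apath a ?s b" using w by (rule apath_awalk_to_apath)
    then have "awalk a ?s b" by (rule awalkI_apath)
    have "u \<notin> set (awalk_verts a ?s)"
      using uw awalk_to_apath_subset[OF w] set_awalk_verts[OF w] set_awalk_verts[OF \<open>awalk a ?s b\<close>]
      by auto
    moreover have "?s \<noteq> []"
      using s \<open>a \<noteq> b\<close> by (auto simp: apath_Nil_iff)
    moreover have closed: "awalk u ((u, a) # ?s @ [(b, u)]) u"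
      using \<open>awalk a ?s b\<close> dG arcs_symmetric[OF eG] in_arcsD1[OF dG]
      by (simp add: awalk_simps)
    moreover have "awalk_verts a (?s @ [(b, u)]) = awalk_verts a ?s @ [u]"
      using awalk_verts_append[of a ?s "[(b, u)]" u] \<open>awalk a ?s b\<close> closed
      by (simp add: awalk_simps)
    ultimately have "cycle ((u, a) # ?s @ [(b, u)])" "3 \<le> length ((u, a) # ?s @ [(b, u)])"
      using s unfolding cycle_def by (auto simp: apath_def Suc_le_eq intro!: exI[of _ u])
    then show ?thesis by blast
  qed
qed

end

text \<open>Without long cycles, paths between two vertices are unique, so each vertex other than
  the root has a well-defined parent: its predecessor on the path from the root.\<close>

lemma rooted_tree_arborescence:
  assumes "rooted_tree T"
  obtains C where "arborescence C (snd T)" "T = arborescence_graph C (snd T)"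
    "\<And>v. v \<in> pverts (fst T) \<Longrightarrow> descendants T v = C\<^sup>* `` {v}"
proof -
  obtain G r where T: "T = (G, r)" by (cases T)
  interpret G: pair_graph G
    using assms by (simp add: T rooted_tree_def undirected_tree_def)
  have unique: "p = q" if "G.apath u p v" "G.apath u q v" for p q u v
    using assms G.long_cycle_if_two_apaths[OF that]
    by (auto simp: T rooted_tree_def undirected_tree_def)
  have r: "r \<in> pverts G" using assms by (simp add: T rooted_tree_def)
  have ex: "\<exists>p. G.apath r p v" if "v \<in> pverts G" for v
  proof -
    have "strongly_connected G"
      using assms G.sym_arcs
      by (intro G.symmetric_connected_imp_strongly_connected)
        (simp_all add: T rooted_tree_def undirected_tree_def)
    then have "r \<rightarrow>\<^sup>*\<^bsub>G\<^esub> v"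
      using that r by (simp add: strongly_connected_def)
    then show ?thesis
      using G.reachable_awalk G.apath_awalk_to_apath by blast
  qed
  \<comment> \<open>The last arcs of the paths that start at the root.\<close>
  define C where "C = {(u, v). \<exists>p. G.apath r (p @ [(u, v)]) v}"
  have apath_prefix: "G.apath r p u" "(u, v) \<in> parcs G" "v \<notin> set (G.awalk_verts r p)"
    if "G.apath r (p @ [(u, v)]) w" for p u v w
    using that by (auto simp: G.apath_append_iff G.apath_simps)
  \<comment> \<open>Every prefix of a path from the root is again such a path, so its last arc lies
    in \<open>C\<close>.\<close>
  have suffix: "(x, v) \<in> C\<^sup>*" if "G.apath r (p @ q) v" "x = G.awlast r p" for p q v x
    using that
  proof (induction q arbitrary: v rule: rev_induct)
    case Nil
    then show ?case by (auto simp: G.apath_def)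
  next
    case (snoc e q)
    obtain y z where e: "e = (y, z)" by (cases e)
    have "z = v" using snoc.prems(1) e by (auto simp: G.apath_append_iff G.apath_simps)
    have "G.apath r (p @ q) y" using snoc.prems(1) apath_prefix(1)[of "p @ q" y z v] e by simp
    then have "(x, y) \<in> C\<^sup>*" using snoc by blast
    moreover have "(y, v) \<in> C"
      using snoc.prems(1) e \<open>z = v\<close> by (auto simp: C_def intro!: exI[of _ "p @ q"])
    ultimately show ?case by (rule rtrancl_into_rtrancl)
  qed
  have reach: "(r, v) \<in> C\<^sup>*" if "v \<in> pverts G" for v
    using ex[OF that] suffix[of "[]"] by auto
  have CG: "C \<subseteq> parcs G"
    using apath_prefix(2) by (auto simp: C_def)
  have arb: "arborescence C r"
  proof
    show "finite C" using CG G.pair_finite_arcs by (rule finite_subset)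
    show "u = v" if "(u, w) \<in> C" "(v, w) \<in> C" for u v w
      using that unique by (auto simp: C_def)
    show "(u, r) \<notin> C" for u
      using G.apath_nonempty_ends by (auto simp: C_def)
    show "(r, u) \<in> C\<^sup>*" if "(u, v) \<in> C" for u v
      using that CG reach G.in_arcsD1 by blast
  qed
  have verts: "pverts G = C\<^sup>* `` {r}"
  proof (intro equalityI subsetI)
    fix v assume "v \<in> C\<^sup>* `` {r}"
    then have "(r, v) \<in> C\<^sup>*" by simp
    then show "v \<in> pverts G"
      by cases (use r CG G.in_arcsD2 in auto)
  qed (use reach in auto)
  have "parcs G \<subseteq> C \<union> C\<inverse>"
  proof (intro subrelI)
    fix u v assume uv: "(u, v) \<in> parcs G"
    obtain p where p: "G.apath r p u" using ex[OF G.in_arcsD1[OF uv]] by blast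
    show "(u, v) \<in> C \<union> C\<inverse>"
    \<comment> \<open>If the path to \<open>u\<close> misses \<open>v\<close>, it extends to
      \<open>v\<close> and \<open>u\<close> is the parent. Otherwise its part from \<open>v\<close>
      to \<open>u\<close> must, by uniqueness, be the single arc \<open>(v, u)\<close>, and
      \<open>v\<close> is the parent.\<close>
    proof (cases "v \<in> set (G.awalk_verts r p)")
      case False
      then have "G.apath r (p @ [(u, v)]) v"
        using p uv G.in_arcsD2[OF uv] G.in_arcsD1[OF uv] G.no_loops'[OF uv]
        by (auto simp: G.apath_append_iff G.apath_simps dest: G.awalkI_apath)
      then show ?thesis by (auto simp: C_def)
    next
      case True
      then obtain q s where qs: "p = q @ s" "G.awalk r q v" "G.awalk v s u"
        using p G.awalk_decomp by (meson G.awalkI_apath)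
      then have "G.apath v s u" using p by (auto simp: G.apath_append_iff)
      moreover have "G.apath v [(v, u)] u"
        using G.arcs_symmetric[OF uv] G.in_arcsD1[OF uv] G.no_loops'[OF uv]
        by (simp add: G.apath_simps)
      ultimately have "s = [(v, u)]" using unique by blast
      then show ?thesis using p qs(1) by (auto simp: C_def)
    qed
  qed
  then have arcs: "parcs G = C \<union> C\<inverse>"
    using CG G.arcs_symmetric by auto
  have "descendants T v = C\<^sup>* `` {v}" if v: "v \<in> pverts G" for v
  proof (intro equalityI subsetI)
    fix w assume "w \<in> descendants T v"
    then obtain p where p: "G.apath r p w" "v \<in> set (G.awalk_verts r p)"
      by (auto simp: descendants_def T)
    then obtain q s where "p = q @ s" "G.awalk r q v"
      using G.awalk_decomp by (meson G.awalkI_apath)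
    then show "w \<in> C\<^sup>* `` {v}"
      using suffix p(1) by auto
  next
    fix w assume "w \<in> C\<^sup>* `` {v}"
    then have "(v, w) \<in> C\<^sup>*" by simp
    then have "\<exists>p. G.apath r p w \<and> v \<in> set (G.awalk_verts r p)"
    proof (induction rule: rtrancl_induct)
      case base
      then show ?case using ex[OF v] by (metis G.apath_def G.awalkE' G.awalk_verts_non_Nil last_in_set)
    next
      case (step x y)
      then obtain p q where p: "G.apath r p x" "v \<in> set (G.awalk_verts r p)"
          and q: "G.apath r (q @ [(x, y)]) y"
        by (auto simp: C_def)
      then have "p = q" using apath_prefix(1)[OF q] unique by blast
      then show ?case using p q
        by (intro exI[of _ "q @ [(x, y)]"]) (auto simp: G.awalk_verts_append G.apath_def)
    qed
    then show "w \<in> descendants T v" by (auto simp: descendants_def T)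
  qed
  then show thesis
    using that[of C] arb verts arcs by (simp add: T arborescence_graph_def)
qed

section \<open>Graphs of arborescences are rooted trees\<close>

text \<open>Moves the base point of a cycle to a chosen vertex. Distinctness is phrased with the
  heads of the arcs, a list that is merely rotated, whereas the vertex list repeats the base
  point.\<close>

lemma (in wf_digraph) cycle_rotate_to:
  assumes "cycle c" "w \<in> head G ` set c"
  obtains c' where "awalk w c' w" "distinct (map (head G) c')" "set c' = set c" "length c' = length c"
proof -
  obtain u where u: "awalk u c u" and dist: "distinct (tl (awalk_verts u c))" and "c \<noteq> []"
    using assms(1) by (auto simp: cycle_def)
  have "cas u c u" using u by (simp add: awalk_def)
  then have "distinct (map (head G) c)"
    using dist \<open>c \<noteq> []\<close> by (simp add: awalk_verts_conv')
  obtain q s where c: "c = q @ s" "awalk u q w" "awalk w s u"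
    using awalk_decomp[OF u] assms(2) awalk_verts_arc2[OF u] by blast
  have "awalk w (s @ q) w"
    using c awalk_appendI by blast
  moreover have "distinct (map (head G) (s @ q))"
    using \<open>distinct (map (head G) c)\<close> unfolding c(1) by auto
  ultimately show thesis
    using that[of "s @ q"] by (auto simp: c(1))
qed

context arborescence
begin

lemma pair_graph_arborescence_graph: "pair_graph (fst (arborescence_graph C r))"
proof -
  have irrefl: "(u, u) \<notin> C" for u
    using acyclic by (auto simp: acyclic_def)
  have heads: "(r, v) \<in> C\<^sup>*" if "(u, v) \<in> C" for u v
    using that tail_reachable by (blast intro: rtrancl_into_rtrancl)
  show ?thesis
  proof
    show "fst e \<in> pverts (fst (arborescence_graph C r))"
      "snd e \<in> pverts (fst (arborescence_graph C r))"
      if "e \<in> parcs (fst (arborescence_graph C r))" for e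
      using that heads tail_reachable by (cases e; auto)+
    show "fst e \<noteq> snd e" if "e \<in> parcs (fst (arborescence_graph C r))" for e
      using that irrefl by (cases e) auto
  qed (use finite_arcs finite_descendants in \<open>auto simp: symmetric_def intro!: symI\<close>)
qed

text \<open>On a cycle, a vertex without children on the cycle has two neighbours, both of them its parent.\<close>

lemma arborescence_graph_no_long_cycle:
  assumes "pre_digraph.cycle (with_proj (fst (arborescence_graph C r))) c" "3 \<le> length c"
  shows False
proof -
  interpret G: pair_graph "fst (arborescence_graph C r)"
    by (rule pair_graph_arborescence_graph)
  have "c \<noteq> []" using assms(2) by auto
  then obtain w where w: "w \<in> snd ` set c" and min: "\<And>y. (y, w) \<in> C\<inverse> \<Longrightarrow> y \<notin> snd ` set c"
    using wfE_min[OF wf_converse_arcs, of "snd (hd c)" "snd ` set c"] by (metis hd_in_set imageI)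
  obtain d where d: "G.awalk w d w" "distinct (map snd d)" "set d = set c" "length d = length c"
    using G.cycle_rotate_to[OF assms(1), of w] w by auto
  obtain a d' where d': "d = a # d'" "2 \<le> length d'"
    using d(4) assms(2) by (cases d) auto
  then obtain d'' b where d'': "d' = d'' @ [b]" "1 \<le> length d''"
    by (cases d' rule: rev_cases) auto
  then obtain m e where "d'' = m @ [e]"
    by (cases d'' rule: rev_cases) auto
  \<comment> \<open>Length at least 3 separates the first arc \<open>a\<close> from the last two,
    \<open>e\<close> and \<open>b\<close>. The heads of \<open>a\<close> and \<open>e\<close> are
    then the two neighbours of \<open>w\<close> on the cycle, at different positions.\<close>
  then have d_eq: "d = a # m @ [e, b]"
    using d' d'' by simp
  then have "G.awalk w (a # m @ [e, b]) w"
    using d(1) by simp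
  then have a: "a \<in> C \<union> C\<inverse>" "fst a = w"
    and "G.awalk (last (pawalk_verts (snd a) m)) [e, b] w"
    unfolding G.awalk_Cons_iff[of w] G.awalk_append_iff arborescence_graph_simps by blast+
  then have b: "b \<in> C \<union> C\<inverse>" "snd b = w" and e: "snd e = fst b"
    unfolding G.awalk_simps arborescence_graph_simps by auto
  have "snd a \<in> snd ` set c" "snd e \<in> snd ` set c"
    unfolding d(3)[symmetric] by (auto simp: d_eq)
  then have "(w, snd a) \<notin> C" "(w, fst b) \<notin> C"
    using min e by auto
  then have "(snd a, w) \<in> C" "(fst b, w) \<in> C"
    using a b by (metis Un_iff converse_iff prod.collapse)+
  then have "snd a = snd e"
    using parent_unique e by simp
  then show False
    using d(2) by (auto simp: d_eq)
qed

lemma rooted_tree_arborescence_graph: "rooted_tree (arborescence_graph C r)"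
proof -
  interpret G: pair_graph "fst (arborescence_graph C r)"
    by (rule pair_graph_arborescence_graph)
  have "r \<rightarrow>\<^sup>*\<^bsub>fst (arborescence_graph C r)\<^esub> v" if "(r, v) \<in> C\<^sup>*" for v
    using that
  proof (induction rule: rtrancl_induct)
    case base
    show ?case by (rule G.reachable_refl) simp
  next
    case (step x y)
    then show ?case by (auto intro: G.reachable_adj_trans)
  qed
  then have "strongly_connected (fst (arborescence_graph C r))"
    unfolding strongly_connected_def
    by (auto intro: G.reachable_trans symmetric_reachable[OF G.pair_sym_arcs])
  then have "connected (fst (arborescence_graph C r))"
    by (intro G.connectedI) (auto simp: strongly_connected_def intro: G.reachable_mk_symmetricI)
  then show ?thesis
    using pair_graph_arborescence_graph arborescence_graph_no_long_cycle
    by (auto simp: rooted_tree_def undirected_tree_def)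
qed

text \<open>The path-based descendants are known for the orientation extracted from the graph, and
  uniqueness of the orientation identifies it with \<open>C\<close>.\<close>

lemma descendants_arborescence_graph:
  assumes "v \<in> C\<^sup>* `` {r}"
  shows "descendants (arborescence_graph C r) v = C\<^sup>* `` {v}"
proof -
  let ?T = "arborescence_graph C r"
  obtain D where D: "arborescence D r" "?T = arborescence_graph D r"
    "\<And>v. v \<in> pverts (fst ?T) \<Longrightarrow> descendants ?T v = D\<^sup>* `` {v}"
    using rooted_tree_arborescence[OF rooted_tree_arborescence_graph]
    unfolding arborescence_graph_simps by blast
  have "C \<union> C\<inverse> = D \<union> D\<inverse>"
    using arg_cong[OF D(2), of "\<lambda>T. parcs (fst T)"] by simp
  then have "C = D"
    using arborescence_orientation_unique[OF arborescence_axioms D(1)] by blast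
  then show ?thesis using D(3) assms by simp
qed

lemma max_limb_arborescence_graph:
  assumes "v \<in> C\<^sup>* `` {r}"
  shows "max_limb (arborescence_graph C r) v =
    arborescence_graph (C \<inter> (C\<^sup>* `` {v}) \<times> (C\<^sup>* `` {v})) v"
  unfolding max_limb_def descendants_arborescence_graph[OF assms]
  by (auto simp: arborescence_graph_def descendants_sub_arborescence)

end

section \<open>Hereditary multisets as shapes of arborescences\<close>

text \<open>Branches are unordered and counted with multiplicity, so that isomorphism of trees can
  become equality.\<close>

datatype rtree = Node "rtree multiset"

primrec order_rtree :: "rtree \<Rightarrow> nat" where
  "order_rtree (Node M) = Suc (\<Sum>\<^sub># (image_mset order_rtree M))"

primrec limbs :: "rtree \<Rightarrow> rtree set" where
  "limbs (Node M) = insert (Node M) (\<Union> (set_mset (image_mset limbs M)))"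

text \<open>Recursion along the converse of \<open>C\<close>, so that the shapes of the children
  come first. The intended equation is \<open>shape_unfold\<close>.\<close>

definition shape :: "'a rel \<Rightarrow> 'a \<Rightarrow> rtree" where
  "shape C = wfrec (C\<inverse>) (\<lambda>f v. Node (image_mset f (mset_set (C `` {v}))))"

text \<open>Remove one element and a partner with the same value, then match the rest. Applied to
  the children of two vertices of equal shape, this pairs branches of equal shape.\<close>

lemma image_mset_eq_bij_betw:
  assumes "finite A" "finite B" "image_mset f (mset_set A) = image_mset g (mset_set B)"
  shows "\<exists>h. bij_betw h A B \<and> (\<forall>x\<in>A. g (h x) = f x)"
  using assms
proof (induction A arbitrary: B rule: finite_induct)
  case empty
  then show ?case by (auto simp: mset_set_empty_iff bij_betw_def)
next
  case (insert a A)
  have "f a \<in># image_mset g (mset_set B)"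
    using insert by (metis finite_insert insertI1 finite_set_mset_mset_set imageI set_image_mset)
  then obtain b where b: "b \<in> B" "g b = f a"
    using insert.prems by auto
  have "image_mset f (mset_set A) = image_mset g (mset_set (B - {b}))"
    using insert b by (simp add: mset_set.remove[of B b])
  then obtain h where h: "bij_betw h A (B - {b})" "\<forall>x\<in>A. g (h x) = f x"
    using insert by (metis finite_Diff)
  have "bij_betw (h(a := b)) A (B - {b})"
    using h(1) insert.hyps(2) by (subst bij_betw_cong[of A _ h]) auto
  then have "bij_betw (h(a := b)) (insert a A) (insert b (B - {b}))"
    using insert.hyps(2) by (auto simp: bij_betw_def)
  moreover have "\<forall>x\<in>insert a A. g ((h(a := b)) x) = f x"
    using h(2) b by simp
  ultimately show ?case
    using b by (metis insert_Diff)
qed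

context arborescence
begin

lemma shape_unfold: "shape C v = Node (image_mset (shape C) (mset_set (C `` {v})))"
proof -
  have "shape C v = Node (image_mset (cut (shape C) (C\<inverse>) v) (mset_set (C `` {v})))"
    using wfrec[OF wf_converse_arcs] by (simp add: shape_def)
  also have "\<dots> = Node (image_mset (shape C) (mset_set (C `` {v})))"
    by (auto simp: finite_children cut_apply intro!: image_mset_cong)
  finally show ?thesis .
qed

lemma descendants_unfold: "C\<^sup>* `` {v} = insert v (\<Union>w\<in>C `` {v}. C\<^sup>* `` {w})"
proof (intro equalityI subsetI)
  fix x assume "x \<in> C\<^sup>* `` {v}"
  then have "(v, x) \<in> C\<^sup>*" by simp
  then show "x \<in> insert v (\<Union>w\<in>C `` {v}. C\<^sup>* `` {w})"
    by (cases rule: converse_rtranclE) auto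
qed (auto intro: converse_rtrancl_into_rtrancl)

text \<open>Both sides obey the same recursion: the vertex itself, together with the contributions
  of its children.\<close>

lemma limbs_shape: "limbs (shape C v) = shape C ` (C\<^sup>* `` {v})"
proof (induction v rule: wf_induct_rule[OF wf_converse_arcs])
  case (1 v)
  have "limbs (shape C v) = insert (shape C v) (\<Union>w\<in>C `` {v}. limbs (shape C w))"
    unfolding arg_cong[OF shape_unfold[of v], of limbs]
    by (simp add: finite_children shape_unfold[of v])
  also have "(\<Union>w\<in>C `` {v}. limbs (shape C w)) = (\<Union>w\<in>C `` {v}. shape C ` (C\<^sup>* `` {w}))"
    using 1 by (intro SUP_cong) auto
  finally show ?case
    unfolding descendants_unfold[of v] by (simp add: image_UN)
qed

text \<open>Unique parents make the ancestors of a vertex a chain, so a common descendant would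
  place one child of \<open>v\<close> below another. Its path would pass through the parent
  \<open>v\<close> and close a cycle.\<close>

lemma disjoint_branches:
  assumes "u \<in> C `` {v}" "w \<in> C `` {v}" "u \<noteq> w"
  shows "C\<^sup>* `` {u} \<inter> C\<^sup>* `` {w} = {}"
proof -
  have no: "(x, y) \<notin> C\<^sup>*" if "(v, x) \<in> C" "(v, y) \<in> C" "x \<noteq> y" for x y
  proof
    assume "(x, y) \<in> C\<^sup>*"
    then obtain z where "(x, z) \<in> C\<^sup>*" "(z, y) \<in> C"
      using \<open>x \<noteq> y\<close> by (meson rtranclE)
    then have "(x, v) \<in> C\<^sup>*"
      using parent_unique that(2) by blast
    then show False
      using that(1) acyclic by (meson acyclic_def rtrancl_into_trancl2)
  qed
  have "single_valued (C\<inverse>)"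
    using parent_unique by (auto simp: single_valued_def)
  then have "(u, w) \<in> C\<^sup>* \<or> (w, u) \<in> C\<^sup>*" if "(u, x) \<in> C\<^sup>*" "(w, x) \<in> C\<^sup>*" for x
    using that single_valued_confluent[of "C\<inverse>" x u w] by (auto simp: rtrancl_converse)
  then show ?thesis
    using no assms by blast
qed

lemma order_shape: "order_rtree (shape C v) = card (C\<^sup>* `` {v})"
proof (induction v rule: wf_induct_rule[OF wf_converse_arcs])
  case (1 v)
  have "order_rtree (shape C v) = Suc (\<Sum>w\<in>C `` {v}. order_rtree (shape C w))"
    by (subst shape_unfold) (simp add: sum_unfold_sum_mset image_mset.compositionality o_def)
  also have "(\<Sum>w\<in>C `` {v}. order_rtree (shape C w)) = (\<Sum>w\<in>C `` {v}. card (C\<^sup>* `` {w}))"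
    using 1 by (intro sum.cong) auto
  also have "\<dots> = card (\<Union>w\<in>C `` {v}. C\<^sup>* `` {w})"
    using disjoint_branches by (intro card_UN_disjoint[symmetric] finite_children)
      (auto simp del: Image_singleton_iff intro: finite_descendants)
  also have "Suc \<dots> = card (C\<^sup>* `` {v})"
  proof -
    have "v \<notin> (\<Union>w\<in>C `` {v}. C\<^sup>* `` {w})"
      using acyclic by (auto simp: acyclic_def dest: rtrancl_into_trancl2)
    then show ?thesis
      unfolding descendants_unfold[of v]
      by (intro card_insert_disjoint[symmetric]) (auto simp: finite_children finite_descendants)
  qed
  finally show ?case .
qed

end

text \<open>Shapes are built from the leaves upwards, so a bijection from children to children at
  each vertex suffices. This serves isomorphisms, restrictions to a limb, and embeddings of branches
  alike.\<close>

lemma shape_eq_if_children_bij: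
  assumes "arborescence C r" "arborescence D s"
    and "\<And>x. x \<in> C\<^sup>* `` {v} \<Longrightarrow> bij_betw f (C `` {x}) (D `` {f x})"
  shows "shape C v = shape D (f v)"
proof -
  interpret C: arborescence C r by fact
  interpret D: arborescence D s by fact
  have "shape C x = shape D (f x)" if "x \<in> C\<^sup>* `` {v}" for x
    using that
  proof (induction x rule: wf_induct_rule[OF C.wf_converse_arcs])
    case (1 x)
    have "image_mset (shape C) (mset_set (C `` {x})) =
      image_mset (shape D \<circ> f) (mset_set (C `` {x}))"
      using 1 by (intro image_mset_cong) (auto simp: C.finite_children intro: rtrancl_into_rtrancl)
    also have "\<dots> = image_mset (shape D) (mset_set (f ` (C `` {x})))"
      unfolding multiset.map_comp[symmetric]
      using assms(3)[OF 1(2)] by (subst image_mset_mset_set) (auto simp: bij_betw_def)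
    also have "f ` (C `` {x}) = D `` {f x}"
      using assms(3)[OF 1(2)] by (simp add: bij_betw_def)
    finally show ?case
      by (simp add: C.shape_unfold[of x] D.shape_unfold[of "f x"])
  qed
  then show ?thesis by simp
qed

section \<open>Isomorphism and equality of shapes\<close>

lemma (in arborescence) arborescence_image:
  assumes inj: "inj_on f (C\<^sup>* `` {r})"
  shows "arborescence (map_prod f f ` C) (f r)"
proof
  have verts: "(r, u) \<in> C\<^sup>*" "(r, v) \<in> C\<^sup>*" if "(u, v) \<in> C" for u v
    using that tail_reachable by (auto intro: rtrancl_into_rtrancl)
  have eq: "u = v" if "f u = f v" "(r, u) \<in> C\<^sup>*" "(r, v) \<in> C\<^sup>*" for u v
    using inj that by (auto dest: inj_onD)
  show "finite (map_prod f f ` C)"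
    using finite_arcs by simp
  show "u = v" if uw: "(u, w) \<in> map_prod f f ` C" and vw: "(v, w) \<in> map_prod f f ` C" for u v w
  proof -
    obtain x y x' y' where "(x, y) \<in> C" "(x', y') \<in> C" "u = f x" "v = f x'" "f y = f y'"
      using uw vw by auto
    then show ?thesis
      using eq[of y y'] verts parent_unique by blast
  qed
  show "(u, f r) \<notin> map_prod f f ` C" for u
  proof
    assume "(u, f r) \<in> map_prod f f ` C"
    then obtain x y where "(x, y) \<in> C" "f y = f r" by auto
    then show False using eq[of y r] verts root_orphan by blast
  qed
  show "(f r, u) \<in> (map_prod f f ` C)\<^sup>*" if uv: "(u, v) \<in> map_prod f f ` C" for u v
  proof -
    obtain x y where x: "(x, y) \<in> C" "u = f x" using uv by auto
    have "(r, x) \<in> C\<^sup>*" using verts x(1) by blast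
    then have "(f r, f x) \<in> (map_prod f f ` C)\<^sup>*"
      by (induction rule: rtrancl_induct) (auto intro: rtrancl_into_rtrancl)
    then show ?thesis using x by simp
  qed
qed

text \<open>An isomorphism respects only undirected edges. The image of \<open>C\<close> is an
  arborescence with root \<open>s\<close> and the edges of \<open>D\<close>, hence equals
  \<open>D\<close>, so children go to children.\<close>

lemma shape_eq_if_rooted_iso:
  assumes "arborescence C r" "arborescence D s"
    and "rooted_iso (arborescence_graph C r) (arborescence_graph D s)"
  shows "shape C r = shape D s"
proof -
  interpret C: arborescence C r by fact
  have "pair_wf_digraph (fst (arborescence_graph C r))"
    by (rule rooted_tree_wf(1)[OF C.rooted_tree_arborescence_graph])
  then obtain f where bij: "bij_betw f (C\<^sup>* `` {r}) (D\<^sup>* `` {s})"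
    and arcs: "map_prod f f ` (C \<union> C\<inverse>) = D \<union> D\<inverse>" and root: "f r = s"
    using assms(3) by (auto simp: rooted_iso_iff)
  have inj: "inj_on f (C\<^sup>* `` {r})" using bij by (simp add: bij_betw_def)
  have "arborescence (map_prod f f ` C) s"
    using C.arborescence_image[OF inj] root by simp
  moreover have "map_prod f f ` C \<union> (map_prod f f ` C)\<inverse> = D \<union> D\<inverse>"
    unfolding arcs[symmetric] by force
  ultimately have D: "D = map_prod f f ` C"
    using arborescence_orientation_unique[OF _ assms(2)] by blast
  have "bij_betw f (C `` {x}) (D `` {f x})" if x: "x \<in> C\<^sup>* `` {r}" for x
    unfolding bij_betw_def
  proof
    show "inj_on f (C `` {x})"
      using inj by (rule inj_on_subset) (use x in \<open>auto intro: rtrancl_into_rtrancl\<close>)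
    show "f ` (C `` {x}) = D `` {f x}"
    proof (intro equalityI subsetI)
      fix z assume "z \<in> D `` {f x}"
      then obtain u v where uv: "(u, v) \<in> C" "f u = f x" "f v = z"
        by (auto simp: D)
      then have "u = x" using inj x C.tail_reachable by (auto dest: inj_onD)
      then show "z \<in> f ` (C `` {x})" using uv by auto
    qed (force simp: D)
  qed
  then show ?thesis
    using shape_eq_if_children_bij[OF assms(1,2), of r f] root by simp
qed

text \<open>
  The isomorphism is defined by recursion away from the root: once \<open>x\<close> is mapped to a vertex of
  the same shape, a shape-preserving matching \<open>h x (F x)\<close> of the children extends the map to
  the children of \<open>x\<close>.
\<close>

lemma rooted_iso_if_shape_eq:
  assumes "arborescence C r" "arborescence D s" and root_shape: "shape C r = shape D s"
  shows "rooted_iso (arborescence_graph C r) (arborescence_graph D s)"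
proof -
  interpret C: arborescence C r by fact
  interpret D: arborescence D s by fact
  have "\<exists>h. bij_betw h (C `` {x}) (D `` {x'}) \<and> (\<forall>y\<in>C `` {x}. shape D (h y) = shape C y)"
    if "shape C x = shape D x'" for x x'
    using that by (intro image_mset_eq_bij_betw C.finite_children D.finite_children)
      (simp add: C.shape_unfold[of x] D.shape_unfold[of x'])
  then obtain h where h: "\<And>x x'. shape C x = shape D x' \<Longrightarrow>
    bij_betw (h x x') (C `` {x}) (D `` {x'}) \<and> (\<forall>y\<in>C `` {x}. shape D (h x x' y) = shape C y)"
    by metis
  \<comment> \<open>Recursion along \<open>C\<close>: the image of \<open>y\<close> is read off from
    the image of its parent \<open>x\<close>.\<close>
  define F where "F = wfrec C (\<lambda>F y. if y = r then s else let x = THE x. (x, y) \<in> C in h x (F x) y)"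
  have F_root: "F r = s"
    unfolding F_def by (subst wfrec[OF C.wf_arcs]) simp
  have F_child: "F y = h x (F x) y" if "(x, y) \<in> C" for x y
  proof -
    have "y \<noteq> r" using that C.root_orphan by blast
    moreover have "(THE x. (x, y) \<in> C) = x" using that C.parent_unique by blast
    ultimately show ?thesis
      using that unfolding F_def by (subst wfrec[OF C.wf_arcs]) (simp add: cut_apply)
  qed
  have F_shape: "shape C x = shape D (F x)" if "(r, x) \<in> C\<^sup>*" for x
    using that
  proof (induction rule: rtrancl_induct)
    case base
    then show ?case by (simp add: F_root root_shape)
  next
    case (step x y)
    then show ?case using h[OF step.IH] F_child by simp
  qed
  have F_bij: "bij_betw F (C `` {x}) (D `` {F x})" if "(r, x) \<in> C\<^sup>*" for x
    using h[OF F_shape[OF that]] F_child by (subst bij_betw_cong[of _ _ "h x (F x)"]) auto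
  have F_arc: "(F x, F y) \<in> D" if "(x, y) \<in> C" for x y
    using F_bij[OF C.tail_reachable[OF that]] that by (auto simp: bij_betw_def)
  \<comment> \<open>Equal images have the same parent in \<open>D\<close>, so by induction the
    parents coincide, and the matching of their children is injective. The root is the only vertex
    sent to \<open>s\<close>.\<close>
  have F_inj: "x = y" if "(r, x) \<in> C\<^sup>*" "(r, y) \<in> C\<^sup>*" "F x = F y" for x y
    using that
  proof (induction x arbitrary: y rule: rtrancl_induct)
    case base
    from base.prems(1) show ?case
    proof (cases rule: rtranclE)
      case (step z)
      then show ?thesis using F_arc[of z y] base.prems(2) F_root D.root_orphan by metis
    qed
  next
    case (step p x)
    from step.prems(1) show ?case
    proof (cases rule: rtranclE)
      case base
      then show ?thesis using F_arc[OF step.hyps(2)] step.prems(2) F_root D.root_orphan by metis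
    next
      case (step q)
      have "F p = F q"
        using F_arc[OF \<open>(p, x) \<in> C\<close>] F_arc[OF \<open>(q, y) \<in> C\<close>] \<open>F x = F y\<close> D.parent_unique by metis
      then have "p = q"
        using \<open>(r, q) \<in> C\<^sup>*\<close> \<open>\<And>y. (r, y) \<in> C\<^sup>* \<Longrightarrow> F p = F y \<Longrightarrow> p = y\<close> by blast
      then show ?thesis
        using F_bij[OF \<open>(r, p) \<in> C\<^sup>*\<close>] \<open>(p, x) \<in> C\<close> \<open>(q, y) \<in> C\<close> \<open>F x = F y\<close>
        by (auto simp: bij_betw_def dest: inj_onD)
    qed
  qed
  have F_surj: "\<exists>x. (r, x) \<in> C\<^sup>* \<and> F x = z" if "(s, z) \<in> D\<^sup>*" for z
    using that
  proof (induction rule: rtrancl_induct)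
    case base
    then show ?case using F_root by blast
  next
    case (step z w)
    then obtain x where x: "(r, x) \<in> C\<^sup>*" "F x = z" by blast
    then have "w \<in> F ` (C `` {x})"
      using F_bij step.hyps(2) by (auto simp: bij_betw_def)
    then show ?case
      using x(1) by (auto intro: rtrancl_into_rtrancl)
  qed
  have "(s, F x) \<in> D\<^sup>*" if "(r, x) \<in> C\<^sup>*" for x
    using that by (induction rule: rtrancl_induct) (auto simp: F_root intro: rtrancl_into_rtrancl F_arc)
  then have "bij_betw F (C\<^sup>* `` {r}) (D\<^sup>* `` {s})"
    using F_inj F_surj by (force simp: bij_betw_def inj_on_def)
  moreover have "map_prod F F ` C = D"
  proof (intro equalityI subrelI)
    fix z w assume zw: "(z, w) \<in> D"
    then obtain x where x: "(r, x) \<in> C\<^sup>*" "F x = z"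
      using F_surj D.tail_reachable by blast
    then have "w \<in> F ` (C `` {x})"
      using F_bij zw by (auto simp: bij_betw_def)
    then show "(z, w) \<in> map_prod F F ` C"
      using x(2) by (auto intro: rev_image_eqI)
  qed (use F_arc in auto)
  then have "map_prod F F ` (C \<union> C\<inverse>) = D \<union> D\<inverse>"
    by force
  ultimately show ?thesis
    unfolding rooted_iso_iff[OF rooted_tree_wf(1)[OF C.rooted_tree_arborescence_graph]]
      arborescence_graph_simps
    using F_root by blast
qed

section \<open>Realisation of hereditary multisets by trees on the natural numbers\<close>

text \<open>Realise the branches, make disjoint copies and join them under a new root. Indexing the
  copies by list positions accounts for multiplicities.\<close>

lemma ex_arborescence_shape: "\<exists>C. arborescence C (0::nat) \<and> shape C 0 = t"
proof (induction t)
  case (Node M)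
  obtain xs where M: "M = mset xs" by (metis ex_mset)
  have "\<forall>i<length xs. \<exists>C. arborescence C (0::nat) \<and> shape C 0 = xs ! i"
    using Node by (simp add: M)
  then obtain D where D: "\<And>i. i < length xs \<Longrightarrow> arborescence (D i) (0::nat)"
      "\<And>i. i < length xs \<Longrightarrow> shape (D i) 0 = xs ! i"
    by metis
  \<comment> \<open>Vertex \<open>x\<close> of the copy with index \<open>i\<close>; the successor
    keeps 0 free for the new root.\<close>
  define e where "e = (\<lambda>i x. Suc (prod_encode (i, x)))"
  have e [simp]: "e i x = e j y \<longleftrightarrow> i = j \<and> x = y" "e i x \<noteq> 0" "0 \<noteq> e i x" for i j x y
    by (auto simp: e_def)
  define C where "C = (\<lambda>i. (0, e i 0)) ` {..<length xs} \<union>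
    (\<Union>i<length xs. map_prod (e i) (e i) ` D i)"
  have C_root: "C `` {0} = (\<lambda>i. e i 0) ` {..<length xs}"
    by (force simp: C_def)
  have C_branch: "C `` {e i x} = e i ` (D i `` {x})" if "i < length xs" for i x
    using that by (force simp: C_def)
  have "arborescence C 0"
  proof
    show "finite C"
      using arborescence.finite_arcs[OF D(1)] by (simp add: C_def)
    show "u = v" if "(u, w) \<in> C" "(v, w) \<in> C" for u v w
      using that arborescence.parent_unique[OF D(1)] arborescence.root_orphan[OF D(1)]
      by (auto simp: C_def)
    show "(u, 0) \<notin> C" for u
      by (auto simp: C_def)
    show "(0, u) \<in> C\<^sup>*" if uv: "(u, v) \<in> C" for u v
    proof (cases "u = 0")
      case False
      then obtain i x y where i: "i < length xs" "(x, y) \<in> D i" "u = e i x"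
        using uv by (auto simp: C_def)
      have "(0, x) \<in> (D i)\<^sup>*"
        using arborescence.tail_reachable[OF D(1)] i by blast
      then have "(0, e i x) \<in> C\<^sup>*"
      proof (induction rule: rtrancl_induct)
        case base
        have "(0, e i 0) \<in> C" using i(1) by (simp add: C_def)
        then show ?case by blast
      next
        case (step x y)
        then have "(e i x, e i y) \<in> C" using i(1) C_branch[of i x] by blast
        then show ?case using step.IH by (rule rtrancl_into_rtrancl[rotated])
      qed
      then show ?thesis using i by simp
    qed simp
  qed
  then interpret C: arborescence C 0 .
  have "shape C (e i 0) = xs ! i" if i: "i < length xs" for i
  proof -
    have "bij_betw (e i) (D i `` {x}) (C `` {e i x})" for x
      using C_branch[OF i] by (auto simp: bij_betw_def inj_on_def)
    then show ?thesis
      using shape_eq_if_children_bij[OF D(1)[OF i] C.arborescence_axioms, of 0 "e i"] D(2)[OF i]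
      by simp
  qed
  then have "image_mset (\<lambda>i. shape C (e i 0)) (mset_set {..<length xs}) =
      image_mset ((!) xs) (mset_set {..<length xs})"
    by (intro image_mset_cong) simp
  also have "\<dots> = M"
    unfolding M lessThan_atLeast0 mset_upt[symmetric] mset_map[symmetric] map_nth ..
  also have "image_mset (\<lambda>i. shape C (e i 0)) (mset_set {..<length xs}) =
      image_mset (shape C) (mset_set (C `` {0}))"
    unfolding C_root
    by (subst image_mset_mset_set[symmetric])
      (auto simp: inj_on_def multiset.map_comp o_def)
  finally show ?case
    using C.arborescence_axioms C.shape_unfold[of 0] by auto
qed

section \<open>Exchanging two limbs of equal order\<close>

text \<open>The recursion stops at a copy of \<open>a\<close> or \<open>b\<close>: the replacement
  is inserted as it stands.\<close>

primrec swap_limbs :: "rtree \<Rightarrow> rtree \<Rightarrow> rtree \<Rightarrow> rtree" where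
  "swap_limbs a b (Node M) =
    (if Node M = a then b else if Node M = b then a else Node (image_mset (swap_limbs a b) M))"

lemma order_branch_less:
  assumes "t \<in># M"
  shows "order_rtree t < order_rtree (Node M)"
  using sum_mset.remove[of "order_rtree t" "image_mset order_rtree M"] assms by auto

lemma limbs_self: "t \<in> limbs t"
  by (cases t) simp

text \<open>Each passage to a branch lowers the order. Hence of two distinct trees of equal order
  neither is a limb of the other.\<close>

lemma limbs_proper_order: "s \<in> limbs t \<Longrightarrow> s \<noteq> t \<Longrightarrow> order_rtree s < order_rtree t"
proof (induction t)
  case (Node M)
  then obtain u where "u \<in># M" "s \<in> limbs u" by auto
  then show ?case
    using Node.IH[of u] order_branch_less[of u M] by (cases "s = u") auto
qed

lemma order_swap_limbs:
  assumes "order_rtree a = order_rtree b"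
  shows "order_rtree (swap_limbs a b t) = order_rtree t"
proof (induction t)
  case (Node M)
  then have "image_mset order_rtree (image_mset (swap_limbs a b) M) = image_mset order_rtree M"
    by (auto simp: multiset.map_comp intro!: image_mset_cong)
  then show ?case
    using assms by (auto simp del: order_rtree.simps(1)) (simp_all only: order_rtree.simps)
qed

text \<open>The tree has no room for a copy of \<open>a\<close> or \<open>b\<close>.\<close>

lemma swap_limbs_small:
  assumes "order_rtree t < order_rtree a" "order_rtree a = order_rtree b"
  shows "swap_limbs a b t = t"
  using assms(1)
proof (induction t)
  case (Node M)
  have "image_mset (swap_limbs a b) M = image_mset (\<lambda>t. t) M"
    using Node order_branch_less by (intro image_mset_cong) (meson order.strict_trans)
  then show ?case
    using Node.prems assms(2) by auto
qed

text \<open>No new copies arise at the root. Orders are preserved, so a new copy would need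
  \<open>Node M\<close> to have the order of \<open>a\<close>; then all branches are too small to
  change, and the result is \<open>Node M\<close> itself.\<close>

lemma swap_limbs_other:
  assumes "order_rtree a = order_rtree b" "Node M \<noteq> a" "Node M \<noteq> b"
  shows "Node (image_mset (swap_limbs a b) M) \<noteq> a" "Node (image_mset (swap_limbs a b) M) \<noteq> b"
proof -
  have "Node (image_mset (swap_limbs a b) M) = Node M"
    if "order_rtree (Node M) = order_rtree a"
  proof -
    have "image_mset (swap_limbs a b) M = image_mset (\<lambda>t. t) M"
      using assms(1) that order_branch_less[of _ M]
      by (intro image_mset_cong swap_limbs_small) (simp_all del: order_rtree.simps)
    then show ?thesis by simp
  qed
  moreover have "order_rtree (Node (image_mset (swap_limbs a b) M)) = order_rtree (Node M)"
    using order_swap_limbs[OF assms(1), of "Node M"] assms(2,3) by simp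
  ultimately show "Node (image_mset (swap_limbs a b) M) \<noteq> a"
    "Node (image_mset (swap_limbs a b) M) \<noteq> b"
    using assms by metis+
qed

text \<open>An exchanged limb is exchanged back. Elsewhere \<open>swap_limbs_other\<close> ensures
  that the second application recurses into the branches again.\<close>

lemma swap_limbs_involution:
  assumes "order_rtree a = order_rtree b"
  shows "swap_limbs a b (swap_limbs a b t) = t"
proof (induction t)
  case (Node M)
  have "image_mset (swap_limbs a b) (image_mset (swap_limbs a b) M) = image_mset (\<lambda>t. t) M"
    unfolding multiset.map_comp using Node by (intro image_mset_cong) simp
  moreover have "swap_limbs a b a = b" "swap_limbs a b b = a"
    by (cases a; simp) (cases b; auto)
  ultimately show ?case
    using swap_limbs_other[OF assms, of M] by auto
qed

lemma limbs_swap_limbs: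
  assumes "order_rtree a = order_rtree b"
  shows "b \<in> limbs (swap_limbs a b t) \<longleftrightarrow> a \<in> limbs t"
proof (induction t)
  case (Node M)
  consider "Node M = a" | "Node M = b" "a \<noteq> b" | "Node M \<noteq> a" "Node M \<noteq> b" by blast
  then show ?case
  proof cases
    case 1
    then show ?thesis using limbs_self by (auto simp del: limbs.simps)
  next
    case 2
    \<comment> \<open>The swap turns \<open>b\<close> into \<open>a\<close>. The orders agree, so
      neither contains the other and both sides of the equivalence are false.\<close>
    then have "a \<notin> limbs b" "b \<notin> limbs a"
      using limbs_proper_order assms by fastforce+
    then show ?thesis using 2 by (auto simp del: limbs.simps)
  next
    case 3
    then show ?thesis
      using Node swap_limbs_other[OF assms 3] by auto
  qed
qed

lemma card_rtrees_without_limb_eq: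
  assumes "order_rtree a = order_rtree b"
  shows "card {t. order_rtree t = n \<and> a \<notin> limbs t} = card {t. order_rtree t = n \<and> b \<notin> limbs t}"
proof (rule bij_betw_same_card)
  \<comment> \<open>For the way back, \<open>limbs_swap_limbs\<close> is applied to
    \<open>swap_limbs a b t\<close>, and the involution turns the doubly swapped tree into
    \<open>t\<close>.\<close>
  show "bij_betw (swap_limbs a b) {t. order_rtree t = n \<and> a \<notin> limbs t}
    {t. order_rtree t = n \<and> b \<notin> limbs t}"
    using assms
    by (intro bij_betw_byWitness[where f' = "swap_limbs a b"])
      (auto simp: swap_limbs_involution order_swap_limbs limbs_swap_limbs
        limbs_swap_limbs[of a b "swap_limbs a b _", symmetric] simp del: limbs.simps)
qed

section \<open>Shapes of rooted trees\<close>

text \<open>For a rooted tree the choice is harmless, as the orientation is unique.\<close>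

definition rooted_shape :: "'a rooted_graph \<Rightarrow> rtree" where
  "rooted_shape T =
    shape (SOME C. arborescence C (snd T) \<and> T = arborescence_graph C (snd T)) (snd T)"

lemma rooted_tree_shape:
  assumes "rooted_tree T"
  obtains C where "arborescence C (snd T)" "T = arborescence_graph C (snd T)"
    "rooted_shape T = shape C (snd T)"
proof -
  let ?P = "\<lambda>C. arborescence C (snd T) \<and> T = arborescence_graph C (snd T)"
  have "\<exists>C. ?P C"
    using rooted_tree_arborescence[OF assms] by metis
  then have "?P (SOME C. ?P C)" by (rule someI_ex)
  then show thesis using that unfolding rooted_shape_def by blast
qed

lemma rooted_shape_arborescence_graph:
  assumes "arborescence C r"
  shows "rooted_shape (arborescence_graph C r) = shape C r"
proof -
  obtain D where "arborescence D r" "arborescence_graph C r = arborescence_graph D r"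
    "rooted_shape (arborescence_graph C r) = shape D r"
    using rooted_tree_shape[OF arborescence.rooted_tree_arborescence_graph[OF assms]] by auto
  moreover from this(2) have "C \<union> C\<inverse> = D \<union> D\<inverse>"
    by (simp add: arborescence_graph_def)
  ultimately show ?thesis
    using arborescence_orientation_unique[OF assms] by metis
qed

lemma rooted_iso_iff_shape:
  assumes "rooted_tree S" "rooted_tree T"
  shows "rooted_iso S T \<longleftrightarrow> rooted_shape S = rooted_shape T"
  using rooted_tree_shape[OF assms(1)] rooted_tree_shape[OF assms(2)]
    shape_eq_if_rooted_iso rooted_iso_if_shape_eq by metis

lemma order_rooted_shape:
  assumes "rooted_tree T"
  shows "order_rtree (rooted_shape T) = num_verts T"
proof -
  obtain C where C: "arborescence C (snd T)" "T = arborescence_graph C (snd T)"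
      "rooted_shape T = shape C (snd T)"
    using rooted_tree_shape[OF assms] .
  have "num_verts T = card (C\<^sup>* `` {snd T})"
    by (subst C(2)) (simp add: num_verts_def)
  then show ?thesis
    using arborescence.order_shape[OF C(1)] C(3) by simp
qed

lemma has_max_limb_iff_shape:
  assumes "rooted_tree T" "rooted_tree L"
  shows "has_max_limb T L \<longleftrightarrow> rooted_shape L \<in> limbs (rooted_shape T)"
proof -
  obtain C where C: "arborescence C (snd T)" "T = arborescence_graph C (snd T)"
      "rooted_shape T = shape C (snd T)"
    using rooted_tree_shape[OF assms(1)] .
  interpret C: arborescence C "snd T" by fact
  have verts: "pverts (fst T) = C\<^sup>* `` {snd T}"
    by (subst C(2)) simp
  have "rooted_iso (max_limb T v) L \<longleftrightarrow> rooted_shape L = shape C v" if v: "v \<in> C\<^sup>* `` {snd T}" for v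
  proof -
    define B where "B = C \<inter> (C\<^sup>* `` {v}) \<times> (C\<^sup>* `` {v})"
    have B: "arborescence B v"
      unfolding B_def by (rule C.sub_arborescence)
    have limb: "max_limb T v = arborescence_graph B v"
      unfolding B_def using C.max_limb_arborescence_graph[OF v] C(2) by simp
    \<comment> \<open>A descendant of \<open>v\<close> keeps all its children in the limb at
      \<open>v\<close>, so its shape is the same there as in the whole tree.\<close>
    have "bij_betw id (B `` {x}) (C `` {id x})" if "x \<in> B\<^sup>* `` {v}" for x
      using that unfolding B_def C.descendants_sub_arborescence
      by (auto simp: bij_betw_def intro: rtrancl_into_rtrancl)
    then have "shape B v = shape C v"
      using shape_eq_if_children_bij[OF B C(1), of v id] by simp
    then show ?thesis
      unfolding limb
      using rooted_iso_iff_shape[OF arborescence.rooted_tree_arborescence_graph[OF B] assms(2)]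
        rooted_shape_arborescence_graph[OF B] by auto
  qed
  then show ?thesis
    unfolding has_max_limb_def verts C(3) C.limbs_shape by auto
qed

lemma ex_rooted_tree_shape: "\<exists>T :: nat rooted_graph. rooted_tree T \<and> rooted_shape T = t"
  using ex_arborescence_shape[of t] arborescence.rooted_tree_arborescence_graph
    rooted_shape_arborescence_graph by metis

section \<open>Counting isomorphism classes by shapes\<close>

text \<open>Both images are in bijection with the common fibres in \<open>A\<close>. This trades
  isomorphism classes for shapes.\<close>

lemma card_image_eq_if_same_kernel:
  assumes "\<And>x y. x \<in> A \<Longrightarrow> y \<in> A \<Longrightarrow> f x = f y \<longleftrightarrow> g x = g y"
  shows "card (f ` A) = card (g ` A)"
proof (rule bij_betw_same_card)
  have "g (inv_into A f (f x)) = g x" if "x \<in> A" for x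
    using assms[of "inv_into A f (f x)" x] that
    by (simp add: inv_into_into f_inv_into_f)
  then show "bij_betw (g \<circ> inv_into A f) (f ` A) (g ` A)"
    using assms by (auto simp: bij_betw_def inj_on_def image_comp)
qed

text \<open>The shape is a complete isomorphism invariant that records order and limbs, and every
  hereditary multiset is the shape of a tree on the natural numbers.\<close>

lemma num_trees_without_limb_eq_card_shapes:
  assumes "rooted_tree L"
  shows "num_trees_without_limb L n =
    card {t. order_rtree t = n \<and> rooted_shape L \<notin> limbs t}"
proof -
  let ?r = "{(S :: nat rooted_graph, T :: nat rooted_graph). rooted_iso S T}"
  let ?A = "trees_without_limb L n"
  have tree: "rooted_tree T" if "T \<in> ?A" for T
    using that by (simp add: trees_without_limb_def)
  have "?A // ?r = (\<lambda>T. ?r `` {T}) ` ?A"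
    by (auto simp: quotient_def)
  moreover have "card ((\<lambda>T. ?r `` {T}) ` ?A) = card (rooted_shape ` ?A)"
  proof (rule card_image_eq_if_same_kernel)
    fix S T assume "S \<in> ?A" "T \<in> ?A"
    then have S: "rooted_tree S" and T: "rooted_tree T" using tree by auto
    \<comment> \<open>The relation \<open>?r\<close> is not confined to trees, so the classes are
      compared by hand, by transitivity with an arbitrary third graph.\<close>
    have "?r `` {S} = ?r `` {T} \<longleftrightarrow> rooted_iso S T"
    proof
      assume eq: "?r `` {S} = ?r `` {T}"
      have "T \<in> ?r `` {S}"
        unfolding eq using rooted_iso_refl[OF rooted_tree_wf(1)[OF T]] by simp
      then show "rooted_iso S T"
        by simp
    next
      assume ST: "rooted_iso S T"
      then have TS: "rooted_iso T S"
        using rooted_iso_iff_shape S T by metis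
      show "?r `` {S} = ?r `` {T}"
        using rooted_iso_trans[OF _ _ ST] rooted_iso_trans[OF _ _ TS]
          rooted_tree_wf(1)[OF S] rooted_tree_wf(1)[OF T] by auto
    qed
    then show "?r `` {S} = ?r `` {T} \<longleftrightarrow> rooted_shape S = rooted_shape T"
      using rooted_iso_iff_shape S T by metis
  qed
  moreover have "rooted_shape ` ?A = {t. order_rtree t = n \<and> rooted_shape L \<notin> limbs t}"
  proof (intro equalityI subsetI)
    fix t assume t: "t \<in> {t. order_rtree t = n \<and> rooted_shape L \<notin> limbs t}"
    obtain T :: "nat rooted_graph" where "rooted_tree T" "rooted_shape T = t"
      using ex_rooted_tree_shape by blast
    then show "t \<in> rooted_shape ` ?A"
      using t assms by (auto simp: trees_without_limb_def order_rooted_shape has_max_limb_iff_shape)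
  qed (use assms in \<open>auto simp: trees_without_limb_def order_rooted_shape has_max_limb_iff_shape\<close>)
  ultimately show ?thesis
    by (simp add: num_trees_without_limb_def)
qed

theorem theorem5p1:
  fixes L1 :: "'a rooted_graph" and L2 :: "'b rooted_graph" and l n :: nat
  assumes "rooted_tree L1" and "rooted_tree L2"
    and "num_verts L1 = l" and "num_verts L2 = l"
    and "\<not> rooted_iso L1 L2"
  shows "num_trees_without_limb L1 n = num_trees_without_limb L2 n"
  using assms card_rtrees_without_limb_eq
  by (simp add: num_trees_without_limb_eq_card_shapes order_rooted_shape)

end
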